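(* Let $(X,\pi)$ be a holomorphic Poisson manifold, with $\pi\in\Gamma(\wedge^2T^{1,0}X)$, and write $\pi=\pi_R+i\pi_I$ with $\pi_R,\pi_I\in\Gamma(\wedge^2TX)$ real bivector fields. Then: (a) Under the decomposition $\wedge^2T_{\mathbb C}X=\wedge^2T^{1,0}X\oplus(T^{1,0}X\wedge T^{0,1}X)\oplus\wedge^2T^{0,1}X$, one has $$\pi_R=\tfrac{\pi}{2}+0+\tfrac{\overline{\pi}}{2},\qquad \pi_I=\tfrac{\pi}{2i}+0+\tfrac{-\overline{\pi}}{2i}.$$ (b) For every open $U\subset X$ and all holomorphic functions $f,g$ on $U$, $$\{f,g\}_R=\tfrac12\{f,g\},\quad \{\overline f,\overline g\}_R=\tfrac12\overline{\{f,g\}},\quad \{f,\overline g\}_R=0,$$ $$\{f,g\}_I=-\tfrac i2\{f,g\},\quad \{\overline f,\overline g\}_I=\tfrac i2\overline{\{f,g\}},\quad \{f,\overline g\}_I=0.$$ (c) Both $\pi_R$ and $\pi_I$ are Poisson tensors on the underlying real manifold $X$.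
   Context: $T_{\mathbb C}X=TX\otimes\mathbb C=T^{1,0}X\oplus T^{0,1}X$ is the decomposition into the $+i$- and $-i$-eigenbundles of the almost complex structure $J$. A holomorphic Poisson structure on a complex manifold $X$ is a holomorphic bivector field $\pi\in\Gamma(\wedge^2T^{1,0}X)$, $\bar\partial\pi=0$, with vanishing Schouten bracket $[\pi,\pi]=0$. The associated Poisson bracket on holomorphic functions is $\{f,g\}=\pi(\partial f,\partial g)=\pi(df,dg)$. The brackets $\{f,g\}_R=\pi_R(df,dg)$ and $\{f,g\}_I=\pi_I(df,dg)$ are defined on real-valued smooth functions and extended $\mathbb C$-bilinearly to complex-valued smooth functions. *)

theory Defs
  imports "HOL-Analysis.Analysis"
begin

section \<open>Smooth and holomorphic functions of several variables\<close>

primrec Ck_on :: "nat \<Rightarrow> 'e::euclidean_space set \<Rightarrow> ('e \<Rightarrow> 'b::real_normed_vector) \<Rightarrow> bool" where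
  "Ck_on 0 S = (\<lambda>f. continuous_on S f)"
| "Ck_on (Suc k) S = (\<lambda>f. (\<forall>x\<in>S. f differentiable (at x)) \<and>
      (\<forall>v. Ck_on k S (\<lambda>x. frechet_derivative f (at x) v)))"

text \<open>Only used for open sets \<open>S\<close>, hence the two-sided \<open>at x\<close> above.\<close>

definition smooth_on :: "'e::euclidean_space set \<Rightarrow> ('e \<Rightarrow> 'b::real_normed_vector) \<Rightarrow> bool" where
  "smooth_on S f \<longleftrightarrow> (\<forall>k. Ck_on k S f)"

text \<open>The complex structure of the model space, as a real-linear endomorphism.\<close>

definition J :: "complex ^ 'n \<Rightarrow> complex ^ 'n" where
  "J v = \<i> *s v"

definition dbar :: "(complex ^ 'n \<Rightarrow> complex) \<Rightarrow> complex ^ 'n \<Rightarrow> complex ^ 'n \<Rightarrow> complex" where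
  "dbar f x = (\<lambda>v. (frechet_derivative f (at x) v + \<i> * frechet_derivative f (at x) (J v)) / 2)"

text \<open>Complex differentiability: the real derivative exists and is complex linear.\<close>

definition holomorphic_fun_on :: "(complex ^ 'n) set \<Rightarrow> (complex ^ 'n \<Rightarrow> complex) \<Rightarrow> bool" where
  "holomorphic_fun_on S f \<longleftrightarrow> (\<forall>x\<in>S. f differentiable (at x) \<and> dbar f x = (\<lambda>v. 0))"

section \<open>Manifolds\<close>

type_synonym ('a, 'e) chart = "'a set \<times> ('a \<Rightarrow> 'e)"

definition coords :: "('a, 'e) chart \<Rightarrow> 'e set" where
  "coords c = snd c ` fst c"

definition param :: "('a, 'e) chart \<Rightarrow> 'e \<Rightarrow> 'a" where
  "param c = inv_into (fst c) (snd c)"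

definition is_chart :: "'a topology \<Rightarrow> ('a, 'e::euclidean_space) chart \<Rightarrow> bool" where
  "is_chart X c \<longleftrightarrow> openin X (fst c) \<and> open (coords c) \<and>
     homeomorphic_map (subtopology X (fst c)) (top_of_set (coords c)) (snd c)"

definition overlap :: "('a, 'e) chart \<Rightarrow> ('a, 'e) chart \<Rightarrow> 'e set" where
  "overlap c d = snd c ` (fst c \<inter> fst d)"

definition transition :: "('a, 'e) chart \<Rightarrow> ('a, 'e) chart \<Rightarrow> 'e \<Rightarrow> 'e" where
  "transition c d = snd d \<circ> param c"

definition smooth_manifold :: "'a topology \<Rightarrow> ('a, 'e::euclidean_space) chart set \<Rightarrow> bool" where
  "smooth_manifold X A \<longleftrightarrow>
     Hausdorff_space X \<and> second_countable X \<and>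
     (\<forall>c\<in>A. is_chart X c) \<and> topspace X = \<Union>(fst ` A) \<and>
     (\<forall>c\<in>A. \<forall>d\<in>A. smooth_on (overlap c d) (transition c d))"

text \<open>
  The same atlas serves for the complex manifold and for its underlying real manifold: charts take
  values in \<open>\<complex>\<^sup>n\<close>, which is also a real Euclidean space. Smoothness of the transition maps is
  implied by their holomorphy (Cauchy's formula), so that clause of the first conjunct is
  redundant.
\<close>

definition complex_manifold :: "'a topology \<Rightarrow> ('a, complex ^ 'n::finite) chart set \<Rightarrow> bool" where
  "complex_manifold X A \<longleftrightarrow> smooth_manifold X A \<and>
     (\<forall>c\<in>A. \<forall>d\<in>A. \<forall>k. holomorphic_fun_on (overlap c d) (\<lambda>x. transition c d x $ k))"

definition holomorphic_on_mfd ::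
    "('a, complex ^ 'n::finite) chart set \<Rightarrow> 'a set \<Rightarrow> ('a \<Rightarrow> complex) \<Rightarrow> bool" where
  "holomorphic_on_mfd A U f \<longleftrightarrow>
     (\<forall>c\<in>A. holomorphic_fun_on (snd c ` (fst c \<inter> U)) (f \<circ> param c))"

section \<open>Complexified tangent vectors and bivectors\<close>

text \<open>
  A chart identifies each tangent space of the real manifold with the model space \<open>'e\<close>.
  Its complexification is \<open>'e \<times> 'e\<close>, where \<open>(u, w)\<close> stands for \<open>u + \<i>w\<close>, and the complexified
  cotangent space consists of the real-linear maps from \<open>'e\<close> to \<open>\<complex>\<close>. Elements of the exterior
  square are realised as alternating complex-bilinear forms on covectors, by
  \<open>(v \<and> w)(\<alpha>, \<beta>) = \<alpha>(v) \<beta>(w) - \<alpha>(w) \<beta>(v)\<close>.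
\<close>

type_synonym 'e ctangent = "'e \<times> 'e"
type_synonym 'e covector = "'e \<Rightarrow>\<^sub>L complex"
type_synonym 'e bivector = "'e covector \<Rightarrow> 'e covector \<Rightarrow> complex"

definition pairing :: "'e::euclidean_space covector \<Rightarrow> 'e ctangent \<Rightarrow> complex" where
  "pairing \<alpha> v = blinfun_apply \<alpha> (fst v) + \<i> * blinfun_apply \<alpha> (snd v)"

definition wedge :: "'e::euclidean_space ctangent \<Rightarrow> 'e ctangent \<Rightarrow> 'e bivector" where
  "wedge v w = (\<lambda>\<alpha> \<beta>. pairing \<alpha> v * pairing \<beta> w - pairing \<alpha> w * pairing \<beta> v)"

text \<open>For subspaces \<open>S\<close>, \<open>T\<close> the following is the subspace \<open>S \<and> T\<close> of the exterior square.
  Scalar coefficients can be absorbed into \<open>S\<close>.\<close>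

definition wedge_space ::
    "'e::euclidean_space ctangent set \<Rightarrow> 'e ctangent set \<Rightarrow> 'e bivector set" where
  "wedge_space S T = {(\<lambda>\<alpha> \<beta>. \<Sum>i<m. wedge (v i) (w i) \<alpha> \<beta>) | (m::nat) v w.
      \<forall>i<m. v i \<in> S \<and> w i \<in> T}"

definition real_tangents :: "'e::euclidean_space ctangent set" where
  "real_tangents = {(u, 0) | u. True}"

definition T10 :: "(complex ^ 'n::finite) ctangent set" where
  "T10 = {(u, w). (J u, J w) = (- w, u)}"

definition T01 :: "(complex ^ 'n::finite) ctangent set" where
  "T01 = {(u, w). (J u, J w) = (w, - u)}"

text \<open>\<open>T10\<close> and \<open>T01\<close> are the eigenspaces of the complexified \<open>J\<close> for \<open>\<i>\<close> and \<open>-\<i>\<close>, because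
  \<open>\<i>(u + \<i>w) = -w + \<i>u\<close>.\<close>

definition cnj_covector :: "'e::euclidean_space covector \<Rightarrow> 'e covector" where
  "cnj_covector \<alpha> = Blinfun (\<lambda>v. cnj (blinfun_apply \<alpha> v))"

text \<open>Conjugation of bivectors; it sends \<open>v \<and> w\<close> to the wedge of the conjugate vectors.\<close>

definition cnj_bivector :: "'e::euclidean_space bivector \<Rightarrow> 'e bivector" where
  "cnj_bivector B = (\<lambda>\<alpha> \<beta>. cnj (B (cnj_covector \<alpha>) (cnj_covector \<beta>)))"

text \<open>\<open>(P, Q, R)\<close> are the components of \<open>B\<close> of types (2,0), (1,1) and (0,2).\<close>

definition type_components ::
    "(complex ^ 'n::finite) bivector \<Rightarrow>
     (complex ^ 'n) bivector \<times> (complex ^ 'n) bivector \<times> (complex ^ 'n) bivector \<Rightarrow> bool" where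
  "type_components B = (\<lambda>(P, Q, R).
     P \<in> wedge_space T10 T10 \<and> Q \<in> wedge_space T10 T01 \<and> R \<in> wedge_space T01 T01 \<and>
     B = (\<lambda>\<alpha> \<beta>. P \<alpha> \<beta> + Q \<alpha> \<beta> + R \<alpha> \<beta>))"

section \<open>Bivector fields and the Schouten bracket\<close>

definition pushforward :: "('e::euclidean_space \<Rightarrow> 'e) \<Rightarrow> 'e bivector \<Rightarrow> 'e bivector" where
  "pushforward L B = (\<lambda>\<alpha> \<beta>. B (\<alpha> o\<^sub>L Blinfun L) (\<beta> o\<^sub>L Blinfun L))"

text \<open>
  A field is given by its local representatives: \<open>B c x\<close> is the bivector at the point with
  coordinates \<open>x\<close> in the chart \<open>c\<close>. Values for \<open>x\<close> outside \<open>coords c\<close> are irrelevant. The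
  set \<open>F\<close> is the fibre, a subspace of the complexified exterior square which the differentials of
  the transition maps preserve.
\<close>

type_synonym ('a, 'e) bivector_field = "('a, 'e) chart \<Rightarrow> 'e \<Rightarrow> 'e bivector"

definition smooth_section ::
    "('a, 'e::euclidean_space) chart set \<Rightarrow> 'e bivector set \<Rightarrow> ('a, 'e) bivector_field \<Rightarrow> bool" where
  "smooth_section A F B \<longleftrightarrow>
     (\<forall>c\<in>A. \<forall>x\<in>coords c. B c x \<in> F) \<and>
     (\<forall>c\<in>A. \<forall>\<alpha> \<beta>. smooth_on (coords c) (\<lambda>x. B c x \<alpha> \<beta>)) \<and>
     (\<forall>c\<in>A. \<forall>d\<in>A. \<forall>x\<in>overlap c d.
        B d (transition c d x) = pushforward (frechet_derivative (transition c d) (at x)) (B c x))"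

definition dual_basis :: "'e::euclidean_space \<Rightarrow> 'e covector" where
  "dual_basis b = Blinfun (\<lambda>v. complex_of_real (v \<bullet> b))"

text \<open>
  The Schouten bracket of two bivector fields on an open set of the model space, evaluated at \<open>x\<close>
  on constant covectors (complex-bilinearly extended to complexified bivector fields). In
  coordinates, \<open>[P,Q]\<^sup>i\<^sup>j\<^sup>k\<close> is the cyclic sum over \<open>i,j,k\<close> of
  \<open>\<Sum>l. P\<^sup>l\<^sup>i \<partial>\<^sub>l Q\<^sup>j\<^sup>k + Q\<^sup>l\<^sup>i \<partial>\<^sub>l P\<^sup>j\<^sup>k\<close>. Other conventions differ by an overall sign.
\<close>

definition schouten ::
    "('e::euclidean_space \<Rightarrow> 'e bivector) \<Rightarrow> ('e \<Rightarrow> 'e bivector) \<Rightarrow> 'e \<Rightarrow>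
     'e covector \<Rightarrow> 'e covector \<Rightarrow> 'e covector \<Rightarrow> complex" where
  "schouten P Q x \<alpha> \<beta> \<gamma> =
     (let D = (\<lambda>R b \<eta> \<zeta>. frechet_derivative (\<lambda>y. R y \<eta> \<zeta>) (at x) b);
          S = (\<lambda>\<xi> \<eta> \<zeta>. \<Sum>b\<in>Basis. P x (dual_basis b) \<xi> * D Q b \<eta> \<zeta> + Q x (dual_basis b) \<xi> * D P b \<eta> \<zeta>)
      in S \<alpha> \<beta> \<gamma> + S \<beta> \<gamma> \<alpha> + S \<gamma> \<alpha> \<beta>)"

definition schouten_square_zero ::
    "('a, 'e::euclidean_space) chart set \<Rightarrow> ('a, 'e) bivector_field \<Rightarrow> bool" where
  "schouten_square_zero A B \<longleftrightarrow>
     (\<forall>c\<in>A. \<forall>x\<in>coords c. \<forall>\<alpha> \<beta> \<gamma>. schouten (B c) (B c) x \<alpha> \<beta> \<gamma> = 0)"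

definition real_bivector_field ::
    "('a, 'e::euclidean_space) chart set \<Rightarrow> ('a, 'e) bivector_field \<Rightarrow> bool" where
  "real_bivector_field A B \<longleftrightarrow> smooth_section A (wedge_space real_tangents real_tangents) B"

definition poisson_tensor ::
    "'a topology \<Rightarrow> ('a, 'e::euclidean_space) chart set \<Rightarrow> ('a, 'e) bivector_field \<Rightarrow> bool" where
  "poisson_tensor X A B \<longleftrightarrow>
     smooth_manifold X A \<and> real_bivector_field A B \<and> schouten_square_zero A B"

definition dz :: "'n::finite \<Rightarrow> (complex ^ 'n) covector" where
  "dz k = Blinfun (\<lambda>v. v $ k)"

text \<open>For a section of \<open>\<And>\<^sup>2T\<^sup>1\<^sup>,\<^sup>0\<close>, \<open>dbar\<close> acts on the coefficients in the holomorphic coordinate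
  frame \<open>\<partial>/\<partial>z\<^sub>j \<and> \<partial>/\<partial>z\<^sub>k\<close>, which are the values on \<open>dz j\<close>, \<open>dz k\<close>.\<close>

definition dbar_closed ::
    "('a, complex ^ 'n::finite) chart set \<Rightarrow> ('a, complex ^ 'n) bivector_field \<Rightarrow> bool" where
  "dbar_closed A B \<longleftrightarrow>
     (\<forall>c\<in>A. \<forall>x\<in>coords c. \<forall>j k. dbar (\<lambda>y. B c y (dz j) (dz k)) x = (\<lambda>v. 0))"

definition holomorphic_poisson_manifold ::
    "'a topology \<Rightarrow> ('a, complex ^ 'n::finite) chart set \<Rightarrow>
     ('a, complex ^ 'n) bivector_field \<Rightarrow> bool" where
  "holomorphic_poisson_manifold X A \<pi> \<longleftrightarrow>
     complex_manifold X A \<and> smooth_section A (wedge_space T10 T10) \<pi> \<and>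
     dbar_closed A \<pi> \<and> schouten_square_zero A \<pi>"

definition real_imag_decomposition ::
    "('a, complex ^ 'n::finite) chart set \<Rightarrow> ('a, complex ^ 'n) bivector_field \<Rightarrow>
     ('a, complex ^ 'n) bivector_field \<Rightarrow> ('a, complex ^ 'n) bivector_field \<Rightarrow> bool" where
  "real_imag_decomposition A \<pi> \<pi>R \<pi>I \<longleftrightarrow>
     real_bivector_field A \<pi>R \<and> real_bivector_field A \<pi>I \<and>
     (\<forall>c\<in>A. \<forall>x\<in>coords c. \<pi> c x = (\<lambda>\<alpha> \<beta>. \<pi>R c x \<alpha> \<beta> + \<i> * \<pi>I c x \<alpha> \<beta>))"

section \<open>Brackets of functions\<close>

definition differential :: "('a, 'e::euclidean_space) chart \<Rightarrow> ('a \<Rightarrow> complex) \<Rightarrow> 'a \<Rightarrow> 'e covector" where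
  "differential c f p = Blinfun (frechet_derivative (f \<circ> param c) (at (snd c p)))"

text \<open>For smooth sections the value of \<open>B(df, dg)\<close> at \<open>p\<close> does not depend on the chosen chart.\<close>

definition chart_at :: "('a, 'e) chart set \<Rightarrow> 'a \<Rightarrow> ('a, 'e) chart" where
  "chart_at A p = (SOME c. c \<in> A \<and> p \<in> fst c)"

definition bracket ::
    "('a, 'e::euclidean_space) chart set \<Rightarrow> ('a, 'e) bivector_field \<Rightarrow>
     ('a \<Rightarrow> complex) \<Rightarrow> ('a \<Rightarrow> complex) \<Rightarrow> 'a \<Rightarrow> complex" where
  "bracket A B f g p =
     (let c = chart_at A p in B c (snd c p) (differential c f p) (differential c g p))"

definition re_fun :: "('a \<Rightarrow> complex) \<Rightarrow> 'a \<Rightarrow> complex" where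
  "re_fun f p = complex_of_real (Re (f p))"

definition im_fun :: "('a \<Rightarrow> complex) \<Rightarrow> 'a \<Rightarrow> complex" where
  "im_fun f p = complex_of_real (Im (f p))"

text \<open>The bracket of real-valued functions, extended complex-bilinearly.\<close>

definition ext_bracket ::
    "('a, 'e::euclidean_space) chart set \<Rightarrow> ('a, 'e) bivector_field \<Rightarrow>
     ('a \<Rightarrow> complex) \<Rightarrow> ('a \<Rightarrow> complex) \<Rightarrow> 'a \<Rightarrow> complex" where
  "ext_bracket A B f g p =
     bracket A B (re_fun f) (re_fun g) p - bracket A B (im_fun f) (im_fun g) p +
     \<i> * (bracket A B (re_fun f) (im_fun g) p + bracket A B (im_fun f) (re_fun g) p)"

end

theory Submission
  imports Defs
begin

text \<open>Each of \<open>\<pi>\<^sub>R\<close> and \<open>\<pi>\<^sub>I\<close> is the real part, that is, half the sum of \<open>a \<pi>\<close> and its conjugate, of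
  a constant multiple \<open>a \<pi>\<close>, with \<open>a = 1\<close> for \<open>\<pi>\<^sub>R\<close> and \<open>a = -\<i>\<close> for \<open>\<pi>\<^sub>I\<close>: conjugation fixes real bivectors, so the conjugate of
  \<open>\<pi> = \<pi>\<^sub>R + \<i>\<pi>\<^sub>I\<close> is \<open>\<pi>\<^sub>R - \<i>\<pi>\<^sub>I\<close>, and the two equations can be solved
  (\<open>real_imag_parts_unique\<close>). Every claim is therefore a claim about \<open>Re_multiple a\<close>.

  Conjugation exchanges \<open>T\<^sup>1\<^sup>,\<^sup>0\<close> and \<open>T\<^sup>0\<^sup>,\<^sup>1\<close>, so the formula displays the components of types (2,0)
  and (0,2), and the one of type (1,1) is zero. The components of a bivector are unique because
  evaluating it on the (1,0)-parts, respectively the (0,1)-parts, of two covectors isolates its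
  (2,0)-, respectively (0,2)-component (\<open>type_components_unique\<close>).

  For the brackets, a bivector in \<open>\<And>\<^sup>2T\<^sup>1\<^sup>,\<^sup>0\<close> vanishes as soon as one argument is a covector of type
  (0,1). The differential of a holomorphic function has type (1,0) and that of its conjugate type
  (0,1), so at most one of the two summands of \<open>Re_multiple a \<pi>\<close> contributes to each bracket, and
  none to a mixed one.

  For the Poisson condition, contracting over a basis turns the Schouten square of a field \<open>B\<close> into
  twice the cyclic sum of \<open>B(d(B(\<beta>,\<gamma>)), \<alpha>)\<close>, the Jacobiator of linear coordinates. The function
  \<open>\<pi>(\<beta>,\<gamma>)\<close> is holomorphic for constant \<open>\<beta>\<close> and \<open>\<gamma>\<close>, being a constant combination of the
  coefficients in the frame \<open>\<partial>/\<partial>z\<^sub>j \<and> \<partial>/\<partial>z\<^sub>k\<close>; hence \<open>\<pi>\<close> kills the differentials of the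
  coefficients of its conjugate, and conversely. The mixed terms of the square of
  \<open>Re_multiple a \<pi>\<close> vanish, and what remains is a combination of \<open>[\<pi>,\<pi>] = 0\<close> and its conjugate
  (\<open>schouten_square_Re_multiple\<close>).\<close>

section \<open>Complex linear algebra of covectors\<close>

definition covector_scale :: "complex \<Rightarrow> 'e::euclidean_space covector \<Rightarrow> 'e covector" where
  "covector_scale a \<alpha> = Blinfun (\<lambda>v. a * \<alpha> v)"

lemma blinfun_apply_covector_scale [simp]: "covector_scale a \<alpha> v = a * \<alpha> v"
  unfolding covector_scale_def
  by (subst bounded_linear_Blinfun_apply)
    (auto intro: bounded_linear_const_mult blinfun.bounded_linear_right)

lemma blinfun_apply_cnj_covector [simp]: "cnj_covector \<alpha> v = cnj (\<alpha> v)"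
  unfolding cnj_covector_def
  by (subst bounded_linear_Blinfun_apply)
    (auto intro: bounded_linear_compose[OF bounded_linear_cnj] blinfun.bounded_linear_right)

lemma blinfun_apply_dual_basis [simp]: "dual_basis b v = complex_of_real (v \<bullet> b)"
  unfolding dual_basis_def
  by (subst bounded_linear_Blinfun_apply)
    (auto intro: bounded_linear_compose[OF bounded_linear_of_real] bounded_linear_inner_left)

lemma blinfun_apply_dz [simp]: "dz k v = v $ k"
  unfolding dz_def by (subst bounded_linear_Blinfun_apply) auto

lemma cnj_covector_cnj_covector [simp]: "cnj_covector (cnj_covector \<alpha>) = \<alpha>"
  by (rule blinfun_eqI) simp

definition complex_bilinear :: "'e::euclidean_space bivector \<Rightarrow> bool" where
  "complex_bilinear B \<longleftrightarrow>
     (\<forall>\<alpha> \<beta> \<gamma>. B (\<alpha> + \<beta>) \<gamma> = B \<alpha> \<gamma> + B \<beta> \<gamma>) \<and>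
     (\<forall>\<alpha> \<beta> \<gamma>. B \<gamma> (\<alpha> + \<beta>) = B \<gamma> \<alpha> + B \<gamma> \<beta>) \<and>
     (\<forall>a \<alpha> \<beta>. B (covector_scale a \<alpha>) \<beta> = a * B \<alpha> \<beta>) \<and>
     (\<forall>a \<alpha> \<beta>. B \<alpha> (covector_scale a \<beta>) = a * B \<alpha> \<beta>)"

lemma complex_bilinear_zero:
  assumes "complex_bilinear B"
  shows "B 0 \<beta> = 0" "B \<alpha> 0 = 0"
proof -
  show "B 0 \<beta> = 0"
    using assms unfolding complex_bilinear_def by (metis add_cancel_left_left)
  show "B \<alpha> 0 = 0"
    using assms unfolding complex_bilinear_def by (metis add_cancel_left_left)
qed

lemma complex_bilinear_sum:
  assumes "complex_bilinear B"
  shows "B (\<Sum>i\<in>I. covector_scale (a i) (\<alpha> i)) \<beta> = (\<Sum>i\<in>I. a i * B (\<alpha> i) \<beta>)"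
    and "B \<beta> (\<Sum>i\<in>I. covector_scale (a i) (\<alpha> i)) = (\<Sum>i\<in>I. a i * B \<beta> (\<alpha> i))"
proof -
  show "B (\<Sum>i\<in>I. covector_scale (a i) (\<alpha> i)) \<beta> = (\<Sum>i\<in>I. a i * B (\<alpha> i) \<beta>)"
    by (induction I rule: infinite_finite_induct)
      (use assms in \<open>auto simp: complex_bilinear_zero complex_bilinear_def\<close>)
  show "B \<beta> (\<Sum>i\<in>I. covector_scale (a i) (\<alpha> i)) = (\<Sum>i\<in>I. a i * B \<beta> (\<alpha> i))"
    by (induction I rule: infinite_finite_induct)
      (use assms in \<open>auto simp: complex_bilinear_zero complex_bilinear_def\<close>)
qed

lemma covector_expand_Basis:
  fixes \<alpha> :: "'e::euclidean_space covector"
  shows "\<alpha> = (\<Sum>b\<in>Basis. covector_scale (\<alpha> b) (dual_basis b))"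
proof (rule blinfun_eqI)
  fix v
  have "\<alpha> v = \<alpha> (\<Sum>b\<in>Basis. (v \<bullet> b) *\<^sub>R b)"
    by (simp add: euclidean_representation)
  also have "\<dots> = (\<Sum>b\<in>Basis. (v \<bullet> b) *\<^sub>R \<alpha> b)"
    by (simp add: blinfun.sum_right blinfun.scaleR_right)
  finally show "\<alpha> v = (\<Sum>b\<in>Basis. covector_scale (\<alpha> b) (dual_basis b)) v"
    by (simp add: blinfun.sum_left scaleR_conv_of_real mult.commute)
qed

text \<open>The coordinate sum in the Schouten bracket is the bivector evaluated on a differential, because the
  real dual basis also spans the complex-valued covectors over \<open>\<complex>\<close>.\<close>

lemma complex_bilinear_contract:
  fixes \<alpha> :: "'e::euclidean_space covector"
  assumes "complex_bilinear B"
  shows "(\<Sum>b\<in>Basis. B (dual_basis b) \<xi> * \<alpha> b) = B \<alpha> \<xi>"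
  by (subst (2) covector_expand_Basis)
    (simp add: complex_bilinear_sum[OF assms] mult.commute)

section \<open>Wedge spaces\<close>

text \<open>Reduces a property that is preserved by sums to its verification for a single wedge.\<close>

lemma wedge_space_induct [consumes 1, case_names zero add]:
  assumes "B \<in> wedge_space S T"
    and zero: "P (\<lambda>\<alpha> \<beta>. 0)"
    and add: "\<And>B v w. B \<in> wedge_space S T \<Longrightarrow> P B \<Longrightarrow> v \<in> S \<Longrightarrow> w \<in> T \<Longrightarrow>
      P (\<lambda>\<alpha> \<beta>. B \<alpha> \<beta> + wedge v w \<alpha> \<beta>)"
  shows "P B"
proof -
  have "P (\<lambda>\<alpha> \<beta>. \<Sum>i<m. wedge (v i) (w i) \<alpha> \<beta>)"
    if "\<forall>i<m. v i \<in> S \<and> w i \<in> T" for m and v w :: "nat \<Rightarrow> _"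
    using that
  proof (induction m)
    case (Suc m)
    then have "(\<lambda>\<alpha> \<beta>. \<Sum>i<m. wedge (v i) (w i) \<alpha> \<beta>) \<in> wedge_space S T"
      unfolding wedge_space_def mem_Collect_eq by (intro exI[of _ m] exI[of _ v] exI[of _ w]) auto
    from add[OF this Suc.IH, of "v m" "w m"] Suc.prems show ?case
      by simp
  qed (use zero in simp)
  then show ?thesis
    using assms(1) unfolding wedge_space_def by auto
qed

lemma wedge_space_zero: "(\<lambda>\<alpha> \<beta>. 0) \<in> wedge_space S T"
  unfolding wedge_space_def by (auto intro!: exI[of _ "0::nat"])

lemma wedge_space_add_wedge:
  assumes "B \<in> wedge_space S T" "v \<in> S" "w \<in> T"
  shows "(\<lambda>\<alpha> \<beta>. B \<alpha> \<beta> + wedge v w \<alpha> \<beta>) \<in> wedge_space S T"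
proof -
  obtain m :: nat and v' w' where B: "B = (\<lambda>\<alpha> \<beta>. \<Sum>i<m. wedge (v' i) (w' i) \<alpha> \<beta>)"
    and "\<forall>i<m. v' i \<in> S \<and> w' i \<in> T"
    using assms(1) unfolding wedge_space_def by auto
  then have "(\<lambda>\<alpha> \<beta>. B \<alpha> \<beta> + wedge v w \<alpha> \<beta>) =
      (\<lambda>\<alpha> \<beta>. \<Sum>i<Suc m. wedge ((v'(m := v)) i) ((w'(m := w)) i) \<alpha> \<beta>) \<and>
      (\<forall>i<Suc m. (v'(m := v)) i \<in> S \<and> (w'(m := w)) i \<in> T)"
    using assms(2,3) by (auto simp: less_Suc_eq)
  then show ?thesis
    unfolding wedge_space_def mem_Collect_eq by blast
qed

lemma pairing_add: "pairing (\<alpha> + \<beta>) v = pairing \<alpha> v + pairing \<beta> v"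
  by (simp add: pairing_def blinfun.add_left algebra_simps)

lemma pairing_scale: "pairing (covector_scale a \<alpha>) v = a * pairing \<alpha> v"
  by (simp add: pairing_def algebra_simps)

lemma pairing_cnj: "pairing (cnj_covector \<alpha>) v = cnj (pairing \<alpha> (fst v, - snd v))"
  by (simp add: pairing_def blinfun.minus_right)

lemma complex_bilinear_wedge_space:
  assumes "B \<in> wedge_space S T"
  shows "complex_bilinear B"
  using assms
  by (induction rule: wedge_space_induct)
    (simp_all add: complex_bilinear_def wedge_def pairing_add pairing_scale algebra_simps)

lemma cnj_bivector_wedge:
  "cnj_bivector (wedge v w) = wedge (fst v, - snd v) (fst w, - snd w)"
  by (simp add: cnj_bivector_def wedge_def pairing_cnj)

lemma cnj_bivector_add:
  "cnj_bivector (\<lambda>\<alpha> \<beta>. B \<alpha> \<beta> + C \<alpha> \<beta>) = (\<lambda>\<alpha> \<beta>. cnj_bivector B \<alpha> \<beta> + cnj_bivector C \<alpha> \<beta>)"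
  by (simp add: cnj_bivector_def)

lemma cnj_bivector_real:
  assumes "B \<in> wedge_space real_tangents real_tangents"
  shows "cnj_bivector B = B"
  using assms
proof (induction rule: wedge_space_induct)
  case zero
  then show ?case by (simp add: cnj_bivector_def)
next
  case (add B v w)
  then show ?case
    by (auto simp: cnj_bivector_add cnj_bivector_wedge real_tangents_def)
qed

text \<open>Complex multiplication on \<open>u + \<i>w\<close>, written on pairs.\<close>

definition ctangent_scale :: "complex \<Rightarrow> 'e::euclidean_space ctangent \<Rightarrow> 'e ctangent" where
  "ctangent_scale k v = (Re k *\<^sub>R fst v - Im k *\<^sub>R snd v, Im k *\<^sub>R fst v + Re k *\<^sub>R snd v)"

lemma wedge_ctangent_scale: "wedge (ctangent_scale k v) w \<alpha> \<beta> = k * wedge v w \<alpha> \<beta>"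
proof -
  have "pairing \<alpha> (ctangent_scale k v) = k * pairing \<alpha> v" for \<alpha> :: "'a covector"
    by (simp add: ctangent_scale_def pairing_def blinfun.bilinear_simps complex_eq_iff algebra_simps)
  then show ?thesis
    by (simp add: wedge_def algebra_simps)
qed

lemma wedge_space_scale:
  assumes "B \<in> wedge_space S T" "\<And>v. v \<in> S \<Longrightarrow> ctangent_scale k v \<in> S"
  shows "(\<lambda>\<alpha> \<beta>. k * B \<alpha> \<beta>) \<in> wedge_space S T"
  using assms(1)
proof (induction rule: wedge_space_induct)
  case zero
  then show ?case by (simp add: wedge_space_zero)
next
  case (add B v w)
  from wedge_space_add_wedge[OF add.IH assms(2)[OF add.hyps(2)] add.hyps(3)] show ?case
    by (simp add: wedge_ctangent_scale distrib_left)
qed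

section \<open>Types of vectors and covectors\<close>

lemma J_J [simp]: "J (J v) = - v"
  by (simp add: J_def vec_eq_iff)

lemma J_linear: "linear J"
  by (rule linearI) (simp_all add: J_def vec_eq_iff algebra_simps)

lemma J_diff: "J (u - v) = J u - J v"
  and J_add: "J (u + v) = J u + J v"
  and J_scaleR: "J (r *\<^sub>R v) = r *\<^sub>R J v"
  and J_minus: "J (- v) = - J v"
  by (simp_all add: linear_diff[OF J_linear] linear_add[OF J_linear] linear_scale[OF J_linear]
      linear_neg[OF J_linear])

definition type10 :: "(complex ^ 'n::finite) covector \<Rightarrow> bool" where
  "type10 \<alpha> \<longleftrightarrow> (\<forall>v. \<alpha> (J v) = \<i> * \<alpha> v)"

definition type01 :: "(complex ^ 'n::finite) covector \<Rightarrow> bool" where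
  "type01 \<alpha> \<longleftrightarrow> (\<forall>v. \<alpha> (J v) = - \<i> * \<alpha> v)"

lemma type01_cnj_covector: "type10 \<alpha> \<Longrightarrow> type01 (cnj_covector \<alpha>)"
  by (simp add: type10_def type01_def)

text \<open>A vector \<open>u + \<i>w\<close> of type (0,1) has \<open>w = J u\<close>, and a complex-linear \<open>\<alpha>\<close> sends it to
  \<open>\<alpha>(u) + \<i>\<cdot>\<i>\<alpha>(u) = 0\<close>.\<close>

lemma pairing_type10_T01:
  assumes "type10 \<alpha>" "v \<in> T01"
  shows "pairing \<alpha> v = 0"
proof -
  have "snd v = J (fst v)"
    using assms(2) by (auto simp: T01_def)
  then show ?thesis
    using assms(1) by (simp add: type10_def pairing_def)
qed

lemma pairing_type01_T10:
  assumes "type01 \<alpha>" "v \<in> T10"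
  shows "pairing \<alpha> v = 0"
proof -
  have "snd v = - J (fst v)"
    using assms(2) by (auto simp: T10_def)
  then show ?thesis
    using assms(1) by (simp add: type01_def pairing_def blinfun.minus_right)
qed

definition proj10 :: "(complex ^ 'n::finite) covector \<Rightarrow> (complex ^ 'n) covector" where
  "proj10 \<alpha> = covector_scale (1/2) (\<alpha> - covector_scale \<i> (\<alpha> o\<^sub>L Blinfun J))"

definition proj01 :: "(complex ^ 'n::finite) covector \<Rightarrow> (complex ^ 'n) covector" where
  "proj01 \<alpha> = covector_scale (1/2) (\<alpha> + covector_scale \<i> (\<alpha> o\<^sub>L Blinfun J))"

lemma Blinfun_J [simp]: "Blinfun J v = J v"
  using J_linear by (metis bounded_linear_Blinfun_apply linear_conv_bounded_linear)

lemma proj10_apply: "proj10 \<alpha> v = (\<alpha> v - \<i> * \<alpha> (J v)) / 2"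
  by (simp add: proj10_def blinfun.bilinear_simps)

lemma proj01_apply: "proj01 \<alpha> v = (\<alpha> v + \<i> * \<alpha> (J v)) / 2"
  by (simp add: proj01_def blinfun.bilinear_simps)

lemma type10_proj10: "type10 (proj10 \<alpha>)"
  by (simp add: type10_def proj10_apply blinfun.bilinear_simps algebra_simps)

lemma type01_proj01: "type01 (proj01 \<alpha>)"
  by (simp add: type01_def proj01_apply blinfun.bilinear_simps algebra_simps)

lemma proj10_add_proj01: "proj10 \<alpha> + proj01 \<alpha> = \<alpha>"
  by (rule blinfun_eqI) (simp add: proj10_apply proj01_apply blinfun.bilinear_simps field_simps)

lemma pairing_proj_T10:
  assumes "v \<in> T10"
  shows "pairing (proj10 \<alpha>) v = pairing \<alpha> v" "pairing (proj01 \<alpha>) v = 0"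
  using pairing_type01_T10[OF type01_proj01 assms, of \<alpha>]
    pairing_add[of "proj10 \<alpha>" "proj01 \<alpha>" v] by (simp_all add: proj10_add_proj01)

lemma pairing_proj_T01:
  assumes "v \<in> T01"
  shows "pairing (proj01 \<alpha>) v = pairing \<alpha> v" "pairing (proj10 \<alpha>) v = 0"
  using pairing_type10_T01[OF type10_proj10 assms, of \<alpha>]
    pairing_add[of "proj10 \<alpha>" "proj01 \<alpha>" v] by (simp_all add: proj10_add_proj01)

lemma wedge_space_T10_proj:
  assumes "B \<in> wedge_space T10 T10"
  shows "B (proj10 \<alpha>) (proj10 \<beta>) = B \<alpha> \<beta>" "B (proj01 \<alpha>) (proj01 \<beta>) = 0"
  using assms
  by (induction rule: wedge_space_induct) (simp_all add: wedge_def pairing_proj_T10)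

lemma wedge_space_T01_proj:
  assumes "B \<in> wedge_space T01 T01"
  shows "B (proj01 \<alpha>) (proj01 \<beta>) = B \<alpha> \<beta>" "B (proj10 \<alpha>) (proj10 \<beta>) = 0"
  using assms
  by (induction rule: wedge_space_induct) (simp_all add: wedge_def pairing_proj_T01)

lemma wedge_space_mixed_proj:
  assumes "B \<in> wedge_space T10 T01"
  shows "B (proj01 \<alpha>) (proj01 \<beta>) = 0" "B (proj10 \<alpha>) (proj10 \<beta>) = 0"
  using assms
  by (induction rule: wedge_space_induct) (simp_all add: wedge_def pairing_proj_T10 pairing_proj_T01)

lemma wedge_space_T10_type01:
  assumes "B \<in> wedge_space T10 T10" "type01 \<alpha>"
  shows "B \<alpha> \<beta> = 0" "B \<beta> \<alpha> = 0"
  using assms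
  by (induction rule: wedge_space_induct) (simp_all add: wedge_def pairing_type01_T10)

text \<open>Covectors of one type annihilate the vectors of the other. On two (1,0)-covectors only the
  (2,0)-component survives and on two (0,1)-covectors only the (0,2)-component; the
  (1,1)-component is then the difference.\<close>

lemma type_components_unique:
  assumes "type_components B t" "type_components B s"
  shows "t = s"
proof -
  have *: "u = (\<lambda>\<alpha> \<beta>. B (proj10 \<alpha>) (proj10 \<beta>),
      \<lambda>\<alpha> \<beta>. B \<alpha> \<beta> - B (proj10 \<alpha>) (proj10 \<beta>) - B (proj01 \<alpha>) (proj01 \<beta>),
      \<lambda>\<alpha> \<beta>. B (proj01 \<alpha>) (proj01 \<beta>))"
    if "type_components B u" for u
    using that unfolding type_components_def
    by (auto simp: wedge_space_T10_proj wedge_space_T01_proj wedge_space_mixed_proj fun_eq_iff)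
  show ?thesis
    using *[OF assms(1)] *[OF assms(2)] by simp
qed

lemma T10_T01_split:
  obtains v10 v01 where "v10 \<in> T10" "v01 \<in> T01" "v = (fst v10 + fst v01, snd v10 + snd v01)"
proof
  let ?u = "fst v" and ?w = "snd v"
  (* These are (v - \<i> J v) / 2 and (v + \<i> J v) / 2, where \<i> acts on pairs as (u, w) \<mapsto> (-w, u). *)
  show "((1/2) *\<^sub>R (?u + J ?w), (1/2) *\<^sub>R (?w - J ?u)) \<in> T10"
    by (simp add: T10_def J_add J_diff J_scaleR algebra_simps)
  show "((1/2) *\<^sub>R (?u - J ?w), (1/2) *\<^sub>R (?w + J ?u)) \<in> T01"
    by (simp add: T01_def J_add J_diff J_scaleR algebra_simps)
qed (simp add: prod_eq_iff scaleR_add_right[symmetric] scaleR_2[symmetric])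

lemma type_components_exist:
  assumes "B \<in> wedge_space UNIV UNIV"
  shows "\<exists>t. type_components B t"
  using assms
proof (induction rule: wedge_space_induct)
  case zero
  show ?case
    by (rule exI[of _ "(\<lambda>\<alpha> \<beta>. 0, \<lambda>\<alpha> \<beta>. 0, \<lambda>\<alpha> \<beta>. 0)"])
      (simp add: type_components_def wedge_space_zero)
next
  case (add B v w)
  then obtain P Q R where PQR: "P \<in> wedge_space T10 T10" "Q \<in> wedge_space T10 T01"
    "R \<in> wedge_space T01 T01" and B: "B = (\<lambda>\<alpha> \<beta>. P \<alpha> \<beta> + Q \<alpha> \<beta> + R \<alpha> \<beta>)"
    unfolding type_components_def by auto
  obtain v1 v2 where v: "v1 \<in> T10" "v2 \<in> T01" "v = (fst v1 + fst v2, snd v1 + snd v2)"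
    by (rule T10_T01_split)
  obtain w1 w2 where w: "w1 \<in> T10" "w2 \<in> T01" "w = (fst w1 + fst w2, snd w1 + snd w2)"
    by (rule T10_T01_split)
  have w1': "(- fst w1, - snd w1) \<in> T10"
    using w(1) by (auto simp: T10_def J_minus)
  (* The term v2 \<and> w1 has its factors in the wrong order; it is rewritten as (-w1) \<and> v2. *)
  have "wedge v w = (\<lambda>\<alpha> \<beta>. wedge v1 w1 \<alpha> \<beta> +
      (wedge v1 w2 \<alpha> \<beta> + wedge (- fst w1, - snd w1) v2 \<alpha> \<beta>) + wedge v2 w2 \<alpha> \<beta>)"
    unfolding v(3) w(3)
    by (simp add: wedge_def pairing_def fun_eq_iff blinfun.bilinear_simps algebra_simps)
  then show ?case
    by (intro exI[of _ "(\<lambda>\<alpha> \<beta>. P \<alpha> \<beta> + wedge v1 w1 \<alpha> \<beta>,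
        \<lambda>\<alpha> \<beta>. (Q \<alpha> \<beta> + wedge v1 w2 \<alpha> \<beta>) + wedge (- fst w1, - snd w1) v2 \<alpha> \<beta>,
        \<lambda>\<alpha> \<beta>. R \<alpha> \<beta> + wedge v2 w2 \<alpha> \<beta>)"])
      (use PQR v w w1' in \<open>auto simp: type_components_def B fun_eq_iff intro!: wedge_space_add_wedge\<close>)
qed

text \<open>A (1,0)-covector is complex linear, hence determined by its values on the standard complex basis.\<close>

lemma covector_expand_dz:
  assumes "type10 \<alpha>"
  shows "\<alpha> = (\<Sum>k\<in>UNIV. covector_scale (\<alpha> (axis k 1)) (dz k))"
proof (rule blinfun_eqI)
  fix v
  have scale: "\<alpha> (a *s w) = a * \<alpha> w" for a w
  proof -
    have "a *s w = Re a *\<^sub>R w + Im a *\<^sub>R J w"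
      by (simp add: J_def vec_eq_iff complex_eq_iff)
    then show ?thesis
      using assms by (simp add: type10_def blinfun.bilinear_simps complex_eq_iff)
  qed
  have "\<alpha> v = \<alpha> (\<Sum>k\<in>UNIV. v $ k *s axis k 1)"
    by (simp add: basis_expansion)
  also have "\<dots> = (\<Sum>k\<in>UNIV. v $ k * \<alpha> (axis k 1))"
    by (simp add: blinfun.sum_right scale)
  finally show "\<alpha> v = (\<Sum>k\<in>UNIV. covector_scale (\<alpha> (axis k 1)) (dz k)) v"
    by (simp add: blinfun.sum_left mult.commute)
qed

text \<open>The coefficients of \<open>B(dz\<^sub>j, dz\<^sub>k)\<close> depend only on the covectors. For a field \<open>B\<close> and constant
  covectors this carries holomorphy of the frame coefficients over to all its values.\<close>

lemma wedge_space_T10_expand_dz: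
  assumes "B \<in> wedge_space T10 T10"
  shows "B \<alpha> \<beta> =
    (\<Sum>j\<in>UNIV. \<Sum>k\<in>UNIV. proj10 \<alpha> (axis j 1) * proj10 \<beta> (axis k 1) * B (dz j) (dz k))"
proof -
  note bil = complex_bilinear_sum[OF complex_bilinear_wedge_space[OF assms]]
  have "B \<alpha> \<beta> = B (proj10 \<alpha>) (proj10 \<beta>)"
    using assms by (simp add: wedge_space_T10_proj)
  also have "\<dots> = B (\<Sum>k\<in>UNIV. covector_scale (proj10 \<alpha> (axis k 1)) (dz k))
      (\<Sum>k\<in>UNIV. covector_scale (proj10 \<beta> (axis k 1)) (dz k))"
    using covector_expand_dz[OF type10_proj10, of \<alpha>] covector_expand_dz[OF type10_proj10, of \<beta>]
    by simp
  finally show ?thesis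
    by (simp only: bil(1)) (simp only: bil(2) sum_distrib_left mult.assoc)
qed

section \<open>Real parts of complex multiples of a bivector\<close>

definition Re_multiple :: "complex \<Rightarrow> 'e::euclidean_space bivector \<Rightarrow> 'e bivector" where
  "Re_multiple a B = (\<lambda>\<alpha> \<beta>. (a * B \<alpha> \<beta> + cnj a * cnj_bivector B \<alpha> \<beta>) / 2)"

text \<open>The real and imaginary parts of \<open>B\<close> solve the linear system formed by \<open>B = R + \<i>I\<close> and its
  conjugate; \<open>I\<close> is the real part of \<open>-\<i>B = I - \<i>R\<close>.\<close>

lemma real_imag_parts_unique:
  assumes "R \<in> wedge_space real_tangents real_tangents"
    and "I \<in> wedge_space real_tangents real_tangents"
    and "B = (\<lambda>\<alpha> \<beta>. R \<alpha> \<beta> + \<i> * I \<alpha> \<beta>)"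
  shows "R = Re_multiple 1 B" "I = Re_multiple (- \<i>) B"
proof -
  have "cnj_bivector B = (\<lambda>\<alpha> \<beta>. cnj_bivector R \<alpha> \<beta> - \<i> * cnj_bivector I \<alpha> \<beta>)"
    by (simp add: assms(3) cnj_bivector_def)
  then have "cnj_bivector B = (\<lambda>\<alpha> \<beta>. R \<alpha> \<beta> - \<i> * I \<alpha> \<beta>)"
    using assms(1,2) by (simp add: cnj_bivector_real)
  then show "R = Re_multiple 1 B" "I = Re_multiple (- \<i>) B"
    by (simp_all add: Re_multiple_def assms(3) fun_eq_iff complex_eq_iff)
qed

text \<open>The factor \<open>a\<close> is moved into the first vector, \<open>u = a v\<close>; then the real part of
  \<open>(x + \<i>y) \<and> (s + \<i>t)\<close> is \<open>x \<and> s - y \<and> t\<close>.\<close>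

lemma Re_multiple_real:
  assumes "B \<in> wedge_space S T"
  shows "Re_multiple a B \<in> wedge_space real_tangents real_tangents"
  using assms
proof (induction rule: wedge_space_induct)
  case zero
  then show ?case
    by (simp add: Re_multiple_def cnj_bivector_def wedge_space_zero)
next
  case (add B v w)
  define u where "u = ctangent_scale a v"
  have "(a * wedge v w \<alpha> \<beta> + cnj a * cnj_bivector (wedge v w) \<alpha> \<beta>) / 2 =
      wedge (fst u, 0) (fst w, 0) \<alpha> \<beta> + wedge (- snd u, 0) (snd w, 0) \<alpha> \<beta>" for \<alpha> \<beta>
  proof -
    have "a * wedge v w \<alpha> \<beta> + cnj a * cnj_bivector (wedge v w) \<alpha> \<beta> =
        wedge u w \<alpha> \<beta> + cnj_bivector (wedge u w) \<alpha> \<beta>"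
      by (simp add: u_def cnj_bivector_def wedge_ctangent_scale)
    then show ?thesis
      unfolding cnj_bivector_wedge
      by (simp add: wedge_def pairing_def blinfun.minus_right field_simps)
  qed
  then have "Re_multiple a (\<lambda>\<alpha> \<beta>. B \<alpha> \<beta> + wedge v w \<alpha> \<beta>) = (\<lambda>\<alpha> \<beta>. Re_multiple a B \<alpha> \<beta> +
      wedge (fst u, 0) (fst w, 0) \<alpha> \<beta> + wedge (- snd u, 0) (snd w, 0) \<alpha> \<beta>)"
    by (simp add: Re_multiple_def cnj_bivector_add fun_eq_iff distrib_left add_divide_distrib)
  then show ?case
    using add.IH by (auto intro!: wedge_space_add_wedge simp: real_tangents_def)
qed

lemma cnj_bivector_T01:
  assumes "B \<in> wedge_space T10 T10"
  shows "cnj_bivector B \<in> wedge_space T01 T01"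
  using assms
proof (induction rule: wedge_space_induct)
  case zero
  then show ?case by (simp add: cnj_bivector_def wedge_space_zero)
next
  case (add B v w)
  have conj: "(fst u, - snd u) \<in> T01" if "u \<in> T10" for u :: "(complex ^ 'n) ctangent"
    using that by (auto simp: T10_def T01_def J_minus)
  then show ?case
    unfolding cnj_bivector_add cnj_bivector_wedge
    by (intro wedge_space_add_wedge add.IH conj add.hyps)
qed

lemma type_components_Re_multiple:
  assumes "B \<in> wedge_space T10 T10"
  shows "type_components (Re_multiple a B)
    (\<lambda>\<alpha> \<beta>. a / 2 * B \<alpha> \<beta>, \<lambda>\<alpha> \<beta>. 0, \<lambda>\<alpha> \<beta>. cnj a / 2 * cnj_bivector B \<alpha> \<beta>)"
proof -
  have T10: "ctangent_scale k v \<in> T10" if "v \<in> T10" for k and v :: "(complex ^ 'n) ctangent"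
    using that by (auto simp: T10_def ctangent_scale_def J_diff J_add J_scaleR)
  have T01: "ctangent_scale k v \<in> T01" if "v \<in> T01" for k and v :: "(complex ^ 'n) ctangent"
    using that by (auto simp: T01_def ctangent_scale_def J_diff J_add J_scaleR)
  show ?thesis
    using wedge_space_scale[OF assms T10, of "a / 2"]
      wedge_space_scale[OF cnj_bivector_T01[OF assms] T01, of "cnj a / 2"]
    by (auto simp: type_components_def wedge_space_zero Re_multiple_def fun_eq_iff field_simps)
qed

text \<open>If the first argument is of pure type, only one of the two summands of \<open>Re_multiple\<close> survives.\<close>

lemma Re_multiple_type10:
  assumes "B \<in> wedge_space T10 T10" "type10 \<alpha>"
  shows "Re_multiple a B \<alpha> \<beta> = a / 2 * B \<alpha> \<beta>"
    and "Re_multiple a B (cnj_covector \<alpha>) \<beta> = cnj a / 2 * cnj (B \<alpha> (cnj_covector \<beta>))"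
  using assms wedge_space_T10_type01[OF assms(1) type01_cnj_covector[OF assms(2)]]
  by (simp_all add: Re_multiple_def cnj_bivector_def)

section \<open>Smoothness and real parts\<close>

text \<open>Derivatives at points of \<open>S\<close> involve values nearby, hence the openness of \<open>S\<close>.\<close>

lemma Ck_on_cong:
  assumes "open S" "\<And>x. x \<in> S \<Longrightarrow> f x = g x" "Ck_on k S f"
  shows "Ck_on k S g"
  using assms(2,3)
proof (induction k arbitrary: f g)
  case 0
  then show ?case using continuous_on_cong[of S S f g] by simp
next
  case (Suc k)
  have diff: "f differentiable (at x)" if "x \<in> S" for x
    using Suc.prems that by simp
  have g: "g differentiable (at x)" if "x \<in> S" for x
  proof -
    have "(f has_derivative frechet_derivative f (at x)) (at x)"
      using diff[OF that] by (simp only: frechet_derivative_works[symmetric])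
    then have "(g has_derivative frechet_derivative f (at x)) (at x)"
      by (rule has_derivative_transform_within_open[OF _ assms(1) that]) (rule Suc.prems(1))
    then show ?thesis
      by (rule differentiableI)
  qed
  have fd: "frechet_derivative f (at x) = frechet_derivative g (at x)" if "x \<in> S" for x
    by (rule frechet_derivative_transform_within_open[OF diff[OF that] assms(1) that])
      (rule Suc.prems(1))
  have "Ck_on k S (\<lambda>x. frechet_derivative g (at x) v)" for v
    by (rule Suc.IH[where f = "\<lambda>x. frechet_derivative f (at x) v"]) (use fd Suc.prems in auto)
  then show ?case
    using g by simp
qed

lemma Ck_on_add:
  assumes "open S" "Ck_on k S f" "Ck_on k S g"
  shows "Ck_on k S (\<lambda>x. f x + g x)"
  using assms(2,3)
proof (induction k arbitrary: f g)
  case 0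
  then show ?case by (simp add: continuous_on_add)
next
  case (Suc k)
  have fd: "frechet_derivative (\<lambda>x. f x + g x) (at x) =
      (\<lambda>v. frechet_derivative f (at x) v + frechet_derivative g (at x) v)" if "x \<in> S" for x
    using Suc.prems that
    by (intro frechet_derivative_at[symmetric] has_derivative_add frechet_derivative_works[THEN iffD1]) auto
  have "Ck_on k S (\<lambda>x. frechet_derivative (\<lambda>x. f x + g x) (at x) v)" for v
    by (rule Ck_on_cong[OF assms(1) _ Suc.IH[of "\<lambda>x. frechet_derivative f (at x) v"
            "\<lambda>x. frechet_derivative g (at x) v"]])
      (use fd Suc.prems in auto)
  then show ?case
    using Suc.prems by simp
qed

lemma Ck_on_bounded_linear:
  assumes "open S" "bounded_linear h" "Ck_on k S f"
  shows "Ck_on k S (\<lambda>x. h (f x))"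
  using assms(3)
proof (induction k arbitrary: f)
  case 0
  then show ?case by (simp add: bounded_linear.continuous_on[OF assms(2)])
next
  case (Suc k)
  have der: "((\<lambda>x. h (f x)) has_derivative (\<lambda>v. h (frechet_derivative f (at x) v))) (at x)"
    if "x \<in> S" for x
    using Suc.prems that
    by (intro bounded_linear.has_derivative[OF assms(2)] frechet_derivative_works[THEN iffD1]) auto
  have "Ck_on k S (\<lambda>x. frechet_derivative (\<lambda>x. h (f x)) (at x) v)" for v
    by (rule Ck_on_cong[OF assms(1) _ Suc.IH[of "\<lambda>x. frechet_derivative f (at x) v"]])
      (use frechet_derivative_at[OF der] Suc.prems in \<open>auto dest: fun_cong\<close>)
  then show ?case
    using der by (auto simp: differentiable_def)
qed

lemma cnj_covector_compose: "cnj_covector (\<alpha> o\<^sub>L M) = cnj_covector \<alpha> o\<^sub>L M"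
  by (rule blinfun_eqI) simp

text \<open>A differential of a transition map is a real operator, so pulling back covectors commutes with
  conjugation. Hence real parts of sections satisfy the transformation law again.\<close>

lemma pushforward_Re_multiple:
  "Re_multiple a (pushforward L B) = pushforward L (Re_multiple a B)"
  by (simp add: Re_multiple_def pushforward_def cnj_bivector_def cnj_covector_compose)

lemma real_bivector_field_Re_multiple:
  assumes "smooth_section A F B" "F \<subseteq> wedge_space S T"
    and "\<And>c. c \<in> A \<Longrightarrow> open (coords c)"
  shows "real_bivector_field A (\<lambda>c x. Re_multiple a (B c x))"
  unfolding real_bivector_field_def smooth_section_def
proof (intro conjI ballI allI)
  fix c x assume "c \<in> A" "x \<in> coords c"
  then show "Re_multiple a (B c x) \<in> wedge_space real_tangents real_tangents"
    using assms(1,2) by (intro Re_multiple_real[of _ S T]) (auto simp: smooth_section_def)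
next
  fix c \<alpha> \<beta> assume c: "c \<in> A"
  have lin1: "bounded_linear (\<lambda>z. a / 2 * z)"
    by (rule bounded_linear_mult_right)
  have lin2: "bounded_linear (\<lambda>z. cnj a / 2 * cnj z)"
    by (intro bounded_linear_const_mult bounded_linear_cnj)
  have B: "Ck_on k (coords c) (\<lambda>x. B c x \<alpha> \<beta>)" for k \<alpha> \<beta>
    using assms(1) c unfolding smooth_section_def smooth_on_def by blast
  have "Ck_on k (coords c) (\<lambda>x. a / 2 * B c x \<alpha> \<beta> +
      cnj a / 2 * cnj (B c x (cnj_covector \<alpha>) (cnj_covector \<beta>)))" for k
    by (rule Ck_on_add[OF assms(3)[OF c] Ck_on_bounded_linear[OF assms(3)[OF c] lin1 B]
          Ck_on_bounded_linear[OF assms(3)[OF c] lin2 B]])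
  then show "smooth_on (coords c) (\<lambda>x. Re_multiple a (B c x) \<alpha> \<beta>)"
    by (simp add: smooth_on_def Re_multiple_def cnj_bivector_def add_divide_distrib)
next
  fix c d x assume "c \<in> A" "d \<in> A" "x \<in> overlap c d"
  then show "Re_multiple a (B d (transition c d x)) =
      pushforward (frechet_derivative (transition c d) (at x)) (Re_multiple a (B c x))"
    using assms(1) unfolding smooth_section_def by (simp add: pushforward_Re_multiple)
qed

section \<open>The Schouten square\<close>

definition gradient :: "('e::euclidean_space \<Rightarrow> complex) \<Rightarrow> 'e \<Rightarrow> 'e covector" where
  "gradient f x = Blinfun (frechet_derivative f (at x))"

lemma gradient_apply:
  assumes "(f has_derivative D) (at x)"
  shows "blinfun_apply (gradient f x) = D"
  using assms frechet_derivative_at[OF assms] has_derivative_bounded_linear[OF assms]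
  by (simp add: gradient_def bounded_linear_Blinfun_apply)

lemma has_derivative_gradient:
  assumes "f differentiable (at x)"
  shows "(f has_derivative gradient f x) (at x)"
  using assms gradient_apply unfolding differentiable_def by metis

lemma type10_gradient_iff:
  assumes "f differentiable (at x)"
  shows "type10 (gradient f x) \<longleftrightarrow> dbar f x = (\<lambda>v. 0)"
proof -
  have "frechet_derivative f (at x) = gradient f x"
    using frechet_derivative_at[OF has_derivative_gradient[OF assms]] by simp
  moreover have "z + \<i> * w = 0 \<longleftrightarrow> w = \<i> * z" for z w
    by (auto simp: complex_eq_iff)
  ultimately show ?thesis
    by (simp add: dbar_def type10_def fun_eq_iff)
qed

text \<open>For a Poisson bracket this is the Jacobi identity: each summand is a bracket \<open>{{\<beta>,\<gamma>},\<alpha>}\<close>, with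
  constant covectors in the place of the linear functions that they are.\<close>

lemma schouten_square_contract:
  assumes "complex_bilinear (B x)" "\<And>\<eta> \<zeta>. (\<lambda>y. B y \<eta> \<zeta>) differentiable (at x)"
  shows "schouten B B x \<alpha> \<beta> \<gamma> = 2 * (B x (gradient (\<lambda>y. B y \<beta> \<gamma>) x) \<alpha> +
    B x (gradient (\<lambda>y. B y \<gamma> \<alpha>) x) \<beta> + B x (gradient (\<lambda>y. B y \<alpha> \<beta>) x) \<gamma>)"
proof -
  have "frechet_derivative (\<lambda>y. B y \<eta> \<zeta>) (at x) = gradient (\<lambda>y. B y \<eta> \<zeta>) x" for \<eta> \<zeta>
    using frechet_derivative_at[OF has_derivative_gradient[OF assms(2)]] by simp
  then show ?thesis
    by (simp only: schouten_def Let_def sum.distrib complex_bilinear_contract[OF assms(1)]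
        distrib_left mult_2)
qed

text \<open>With \<open>C\<close> the real part of \<open>a B\<close>, each summand of the Jacobiator of \<open>C\<close> is \<open>(a/2)\<^sup>2\<close> times the
  summand for \<open>B\<close> plus the conjugate of \<open>(a/2)\<^sup>2\<close> times the summand for \<open>B\<close> at the conjugate
  covectors: the cross terms pair a (2,0)-bivector with the differential of an antiholomorphic
  function, or the conjugate situation.\<close>

lemma schouten_square_Re_multiple:
  fixes B C :: "complex ^ 'n::finite \<Rightarrow> (complex ^ 'n) bivector"
  assumes "open S" "x \<in> S"
    and B: "\<And>y. y \<in> S \<Longrightarrow> B y \<in> wedge_space T10 T10"
    and C: "\<And>y. y \<in> S \<Longrightarrow> C y = Re_multiple a (B y)"
    and diff: "\<And>\<eta> \<zeta>. (\<lambda>y. B y \<eta> \<zeta>) differentiable (at x)"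
    and hol: "\<And>j k. dbar (\<lambda>y. B y (dz j) (dz k)) x = (\<lambda>v. 0)"
    and poisson: "\<And>\<alpha> \<beta> \<gamma>. schouten B B x \<alpha> \<beta> \<gamma> = 0"
  shows "schouten C C x \<alpha> \<beta> \<gamma> = 0"
proof -
  let ?dB = "\<lambda>\<eta> \<zeta>. gradient (\<lambda>y. B y \<eta> \<zeta>) x"
  let ?dC = "\<lambda>\<eta> \<zeta>. gradient (\<lambda>y. C y \<eta> \<zeta>) x"
  let ?bar = cnj_covector
  have Bx: "B x \<in> wedge_space T10 T10"
    using B assms(2) .
  (* Holomorphy of B(\<eta>, \<zeta>): its derivative ?G is a constant combination of those of the coefficients. *)
  have type10: "type10 (?dB \<eta> \<zeta>)" for \<eta> \<zeta>
  proof -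
    let ?G = "\<lambda>v. \<Sum>j\<in>UNIV. \<Sum>k\<in>UNIV.
      proj10 \<eta> (axis j 1) * proj10 \<zeta> (axis k 1) * ?dB (dz j) (dz k) v"
    have "((\<lambda>y. \<Sum>j\<in>UNIV. \<Sum>k\<in>UNIV.
        proj10 \<eta> (axis j 1) * proj10 \<zeta> (axis k 1) * B y (dz j) (dz k)) has_derivative ?G) (at x)"
      by (intro has_derivative_sum has_derivative_mult_right has_derivative_gradient diff)
    then have "((\<lambda>y. B y \<eta> \<zeta>) has_derivative ?G) (at x)"
      by (rule has_derivative_transform_within_open[OF _ assms(1,2)])
        (simp only: wedge_space_T10_expand_dz[OF B, symmetric])
    moreover have "type10 (?dB (dz j) (dz k))" for j k
      using hol type10_gradient_iff[OF diff] by blast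
    ultimately show ?thesis
      by (simp add: gradient_apply type10_def sum_distrib_left mult_ac)
  qed
  have dC: "((\<lambda>y. C y \<eta> \<zeta>) has_derivative
      (\<lambda>v. a / 2 * ?dB \<eta> \<zeta> v + cnj a / 2 * cnj (?dB (?bar \<eta>) (?bar \<zeta>) v))) (at x)" for \<eta> \<zeta>
  proof -
    have "((\<lambda>y. a / 2 * B y \<eta> \<zeta> + cnj a / 2 * cnj (B y (?bar \<eta>) (?bar \<zeta>))) has_derivative
        (\<lambda>v. a / 2 * ?dB \<eta> \<zeta> v + cnj a / 2 * cnj (?dB (?bar \<eta>) (?bar \<zeta>) v))) (at x)"
      by (intro has_derivative_add has_derivative_mult_right has_derivative_cnj
          has_derivative_gradient diff)
    then show ?thesis
      by (rule has_derivative_transform_within_open[OF _ assms(1,2)])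
        (simp add: C Re_multiple_def cnj_bivector_def add_divide_distrib)
  qed
  have grad: "?dC \<eta> \<zeta> = covector_scale (a / 2) (?dB \<eta> \<zeta>) +
      covector_scale (cnj a / 2) (?bar (?dB (?bar \<eta>) (?bar \<zeta>)))" for \<eta> \<zeta>
    by (rule blinfun_eqI) (simp add: gradient_apply[OF dC] blinfun.add_left)
  have bilC: "complex_bilinear (C x)"
    unfolding C[OF assms(2)] by (rule complex_bilinear_wedge_space[OF Re_multiple_real[OF Bx]])
  (* Each part of ?dC has pure type, so it meets only one of the two summands of C. *)
  have key: "C x (?dC \<eta> \<zeta>) \<xi> = (a / 2)\<^sup>2 * B x (?dB \<eta> \<zeta>) \<xi> +
      (cnj a / 2)\<^sup>2 * cnj (B x (?dB (?bar \<eta>) (?bar \<zeta>)) (?bar \<xi>))" for \<eta> \<zeta> \<xi>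
  proof -
    have "C x (?dC \<eta> \<zeta>) \<xi> = a / 2 * C x (?dB \<eta> \<zeta>) \<xi> +
        cnj a / 2 * C x (?bar (?dB (?bar \<eta>) (?bar \<zeta>))) \<xi>"
      using bilC unfolding grad complex_bilinear_def by simp
    then show ?thesis
      unfolding C[OF assms(2)] Re_multiple_type10[OF Bx type10]
      by (simp add: power2_eq_square mult.assoc)
  qed
  have cyc: "B x (?dB \<eta> \<zeta>) \<xi> + B x (?dB \<zeta> \<xi>) \<eta> + B x (?dB \<xi> \<eta>) \<zeta> = 0" for \<xi> \<eta> \<zeta>
  proof -
    have "2 * (B x (?dB \<eta> \<zeta>) \<xi> + B x (?dB \<zeta> \<xi>) \<eta> + B x (?dB \<xi> \<eta>) \<zeta>) = 0"
      by (rule trans[OF schouten_square_contract[symmetric] poisson])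
        (rule complex_bilinear_wedge_space[OF Bx] diff)+
    then show ?thesis
      by (simp only: mult_eq_0_iff) simp
  qed
  have "schouten C C x \<alpha> \<beta> \<gamma> = 2 * (C x (?dC \<beta> \<gamma>) \<alpha> + C x (?dC \<gamma> \<alpha>) \<beta> + C x (?dC \<alpha> \<beta>) \<gamma>)"
    by (rule schouten_square_contract[where B = C, OF bilC]) (use dC in \<open>auto simp: differentiable_def\<close>)
  also have "\<dots> = 2 * ((a / 2)\<^sup>2 * (B x (?dB \<beta> \<gamma>) \<alpha> + B x (?dB \<gamma> \<alpha>) \<beta> + B x (?dB \<alpha> \<beta>) \<gamma>) +
      (cnj a / 2)\<^sup>2 * cnj (B x (?dB (?bar \<beta>) (?bar \<gamma>)) (?bar \<alpha>) +
        B x (?dB (?bar \<gamma>) (?bar \<alpha>)) (?bar \<beta>) + B x (?dB (?bar \<alpha>) (?bar \<beta>)) (?bar \<gamma>)))"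
    unfolding key by (simp only: complex_cnj_add distrib_left ac_simps)
  finally show ?thesis
    by (simp only: cyc) simp
qed

section \<open>Brackets of complex-valued functions\<close>

lemma differential_eq_gradient: "differential c f p = gradient (f \<circ> param c) (snd c p)"
  by (simp add: differential_def gradient_def)

lemma differential_cnj:
  assumes "(f \<circ> param c) differentiable (at (snd c p))"
  shows "differential c (cnj \<circ> f) p = cnj_covector (differential c f p)"
proof (rule blinfun_eqI)
  fix v
  show "differential c (cnj \<circ> f) p v = cnj_covector (differential c f p) v"
    using gradient_apply[OF has_derivative_cnj[OF has_derivative_gradient[OF assms]]]
    by (simp add: differential_eq_gradient o_def)
qed

lemma differential_re_im:
  assumes "(f \<circ> param c) differentiable (at (snd c p))"
  shows "differential c f p =
    differential c (re_fun f) p + covector_scale \<i> (differential c (im_fun f) p)"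
proof (rule blinfun_eqI)
  fix v
  let ?x = "snd c p" and ?D = "gradient (f \<circ> param c) (snd c p)"
  have "((\<lambda>y. complex_of_real (Re ((f \<circ> param c) y))) has_derivative
      (\<lambda>v. complex_of_real (Re (?D v)))) (at ?x)"
    by (intro has_derivative_of_real has_derivative_Re has_derivative_gradient assms)
  moreover have "((\<lambda>y. complex_of_real (Im ((f \<circ> param c) y))) has_derivative
      (\<lambda>v. complex_of_real (Im (?D v)))) (at ?x)"
    by (intro has_derivative_of_real has_derivative_Im has_derivative_gradient assms)
  ultimately show "differential c f p v =
      (differential c (re_fun f) p + covector_scale \<i> (differential c (im_fun f) p)) v"
    using complex_eq[of "?D v"]
    by (simp add: differential_eq_gradient gradient_apply re_fun_def im_fun_def o_def
        blinfun.add_left)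
qed

text \<open>The complex-bilinear extension of the bracket of real functions is the evaluation of the
  complex-bilinear form on the complex differentials.\<close>

lemma ext_bracket_eq_bracket:
  assumes "complex_bilinear (B c (snd c p))" "c = chart_at A p"
    and "(f \<circ> param c) differentiable (at (snd c p))" "(g \<circ> param c) differentiable (at (snd c p))"
  shows "ext_bracket A B f g p = B c (snd c p) (differential c f p) (differential c g p)"
  using assms(1) differential_re_im[OF assms(3)] differential_re_im[OF assms(4)]
  unfolding complex_bilinear_def
  by (simp add: ext_bracket_def bracket_def Let_def assms(2)[symmetric] algebra_simps)

lemma ext_bracket_Re_multiple:
  fixes A :: "('a, complex ^ 'n::finite) chart set"
  assumes c: "c = chart_at A p"
    and B: "B c (snd c p) \<in> wedge_space T10 T10"
    and C: "C c (snd c p) = Re_multiple a (B c (snd c p))"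
    and f: "(f \<circ> param c) differentiable (at (snd c p))" "type10 (differential c f p)"
    and g: "(g \<circ> param c) differentiable (at (snd c p))" "type10 (differential c g p)"
  shows "ext_bracket A C f g p = a / 2 * bracket A B f g p"
    and "ext_bracket A C (cnj \<circ> f) (cnj \<circ> g) p = cnj a / 2 * cnj (bracket A B f g p)"
    and "ext_bracket A C f (cnj \<circ> g) p = 0"
proof -
  have bil: "complex_bilinear (C c (snd c p))"
    unfolding C by (rule complex_bilinear_wedge_space[OF Re_multiple_real[OF B]])
  have cnj: "((cnj \<circ> h) \<circ> param c) differentiable (at (snd c p))"
    if "(h \<circ> param c) differentiable (at (snd c p))" for h
    using has_derivative_cnj[OF has_derivative_gradient[OF that]]
    by (auto simp: differentiable_def o_def)
  note Cf = Re_multiple_type10[OF B f(2)]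
  show "ext_bracket A C f g p = a / 2 * bracket A B f g p"
    using ext_bracket_eq_bracket[where B = C, OF bil c f(1) g(1)]
    by (simp add: bracket_def Let_def c[symmetric] C Cf)
  show "ext_bracket A C (cnj \<circ> f) (cnj \<circ> g) p = cnj a / 2 * cnj (bracket A B f g p)"
    using ext_bracket_eq_bracket[where B = C, OF bil c cnj[OF f(1)] cnj[OF g(1)]]
    by (simp add: bracket_def Let_def c[symmetric] C Cf differential_cnj f g)
  show "ext_bracket A C f (cnj \<circ> g) p = 0"
    using ext_bracket_eq_bracket[where B = C, OF bil c f(1) cnj[OF g(1)]]
      wedge_space_T10_type01[OF B type01_cnj_covector[OF g(2)]]
    by (simp add: C Cf differential_cnj g)
qed

lemma holomorphic_on_mfd_differential:
  assumes "holomorphic_on_mfd A U f" "c \<in> A" "p \<in> fst c" "p \<in> U"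
  shows "(f \<circ> param c) differentiable (at (snd c p))" "type10 (differential c f p)"
proof -
  have hol: "(f \<circ> param c) differentiable (at (snd c p)) \<and> dbar (f \<circ> param c) (snd c p) = (\<lambda>v. 0)"
    using assms unfolding holomorphic_on_mfd_def holomorphic_fun_on_def by blast
  then show "(f \<circ> param c) differentiable (at (snd c p))" ..
  with hol show "type10 (differential c f p)"
    by (simp add: differential_eq_gradient type10_gradient_iff)
qed

section \<open>Real and imaginary parts of a holomorphic Poisson structure\<close>

theorem lemma2p3:
  fixes X :: "'a topology"
    and A :: "('a, complex ^ 'n::finite) chart set"
    and \<pi> :: "('a, complex ^ 'n) bivector_field"
  assumes "holomorphic_poisson_manifold X A \<pi>"
  shows "(\<exists>\<pi>R \<pi>I. real_imag_decomposition A \<pi> \<pi>R \<pi>I) \<and>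
    (\<forall>\<pi>R \<pi>I. real_imag_decomposition A \<pi> \<pi>R \<pi>I \<longrightarrow>
      ((\<forall>B \<in> wedge_space UNIV (UNIV :: (complex ^ 'n) ctangent set). \<exists>!t. type_components B t) \<and>
       (\<forall>c\<in>A. \<forall>x\<in>coords c.
          type_components (\<pi>R c x)
            (\<lambda>\<alpha> \<beta>. \<pi> c x \<alpha> \<beta> / 2, \<lambda>\<alpha> \<beta>. 0, \<lambda>\<alpha> \<beta>. cnj_bivector (\<pi> c x) \<alpha> \<beta> / 2) \<and>
          type_components (\<pi>I c x)
            (\<lambda>\<alpha> \<beta>. \<pi> c x \<alpha> \<beta> / (2 * \<i>), \<lambda>\<alpha> \<beta>. 0, \<lambda>\<alpha> \<beta>. - cnj_bivector (\<pi> c x) \<alpha> \<beta> / (2 * \<i>)))) \<and>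
      (\<forall>U f g. openin X U \<and> holomorphic_on_mfd A U f \<and> holomorphic_on_mfd A U g \<longrightarrow>
        (\<forall>p\<in>U.
          ext_bracket A \<pi>R f g p = 1 / 2 * bracket A \<pi> f g p \<and>
          ext_bracket A \<pi>R (cnj \<circ> f) (cnj \<circ> g) p = 1 / 2 * cnj (bracket A \<pi> f g p) \<and>
          ext_bracket A \<pi>R f (cnj \<circ> g) p = 0 \<and>
          ext_bracket A \<pi>I f g p = - \<i> / 2 * bracket A \<pi> f g p \<and>
          ext_bracket A \<pi>I (cnj \<circ> f) (cnj \<circ> g) p = \<i> / 2 * cnj (bracket A \<pi> f g p) \<and>
          ext_bracket A \<pi>I f (cnj \<circ> g) p = 0)) \<and>
      poisson_tensor X A \<pi>R \<and> poisson_tensor X A \<pi>I)"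
proof -
  have cm: "complex_manifold X A" and sec: "smooth_section A (wedge_space T10 T10) \<pi>"
    and hol: "dbar_closed A \<pi>" and poisson: "schouten_square_zero A \<pi>"
    using assms unfolding holomorphic_poisson_manifold_def by auto
  have mfd: "smooth_manifold X A"
    using cm unfolding complex_manifold_def by blast
  have open_coords: "open (coords c)" if "c \<in> A" for c
    using mfd that unfolding smooth_manifold_def is_chart_def by blast
  have T10: "\<pi> c x \<in> wedge_space T10 T10" if "c \<in> A" "x \<in> coords c" for c x
    using sec that unfolding smooth_section_def by blast
  have diff: "(\<lambda>y. \<pi> c y \<alpha> \<beta>) differentiable (at x)" if "c \<in> A" "x \<in> coords c" for c x \<alpha> \<beta>
  proof -
    have "Ck_on (Suc 0) (coords c) (\<lambda>y. \<pi> c y \<alpha> \<beta>)"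
      using sec that unfolding smooth_section_def smooth_on_def by blast
    then show ?thesis
      using that by simp
  qed
  let ?Re = "\<lambda>a c x. Re_multiple a (\<pi> c x)"
  have real: "real_bivector_field A (?Re a)" for a
    using real_bivector_field_Re_multiple[OF sec order_refl open_coords] .
  have exist: "real_imag_decomposition A \<pi> (?Re 1) (?Re (- \<i>))"
    unfolding real_imag_decomposition_def
    by (intro conjI real) (auto simp: Re_multiple_def fun_eq_iff field_simps)
  have parts: "\<pi>R c x = ?Re 1 c x" "\<pi>I c x = ?Re (- \<i>) c x"
    if dec: "real_imag_decomposition A \<pi> \<pi>R \<pi>I" and c: "c \<in> A" "x \<in> coords c"
    for \<pi>R \<pi>I c x
  proof -
    have "\<pi>R c x \<in> wedge_space real_tangents real_tangents"
      "\<pi>I c x \<in> wedge_space real_tangents real_tangents"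
      "\<pi> c x = (\<lambda>\<alpha> \<beta>. \<pi>R c x \<alpha> \<beta> + \<i> * \<pi>I c x \<alpha> \<beta>)"
      using dec c by (auto simp: real_imag_decomposition_def real_bivector_field_def smooth_section_def)
    from real_imag_parts_unique[OF this]
    show "\<pi>R c x = ?Re 1 c x" "\<pi>I c x = ?Re (- \<i>) c x" .
  qed
  have components: "type_components (?Re a c x)
      (\<lambda>\<alpha> \<beta>. a / 2 * \<pi> c x \<alpha> \<beta>, \<lambda>\<alpha> \<beta>. 0, \<lambda>\<alpha> \<beta>. cnj a / 2 * cnj_bivector (\<pi> c x) \<alpha> \<beta>)"
    if "c \<in> A" "x \<in> coords c" for a c x
    using type_components_Re_multiple[OF T10[OF that]] .
  have brackets: "ext_bracket A C f g p = a / 2 * bracket A \<pi> f g p"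
      "ext_bracket A C (cnj \<circ> f) (cnj \<circ> g) p = cnj a / 2 * cnj (bracket A \<pi> f g p)"
      "ext_bracket A C f (cnj \<circ> g) p = 0"
    if C: "\<And>c x. c \<in> A \<Longrightarrow> x \<in> coords c \<Longrightarrow> C c x = ?Re a c x"
      and U: "openin X U" "p \<in> U"
      and fg: "holomorphic_on_mfd A U f" "holomorphic_on_mfd A U g"
    for C a U f g p
  proof -
    define c where "c = chart_at A p"
    have "p \<in> \<Union>(fst ` A)"
      using mfd openin_subset[OF U(1)] U(2) unfolding smooth_manifold_def by auto
    then have "\<exists>c. c \<in> A \<and> p \<in> fst c"
      by blast
    from someI_ex[OF this] have c: "c \<in> A" "p \<in> fst c"
      by (simp_all add: c_def chart_at_def)
    then have x: "snd c p \<in> coords c"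
      by (simp add: coords_def)
    note f = holomorphic_on_mfd_differential[OF fg(1) c U(2)]
    note g = holomorphic_on_mfd_differential[OF fg(2) c U(2)]
    note br = ext_bracket_Re_multiple[where B = \<pi> and C = C, OF c_def T10[OF c(1) x] C[OF c(1) x] f g]
    show "ext_bracket A C f g p = a / 2 * bracket A \<pi> f g p"
      "ext_bracket A C (cnj \<circ> f) (cnj \<circ> g) p = cnj a / 2 * cnj (bracket A \<pi> f g p)"
      "ext_bracket A C f (cnj \<circ> g) p = 0"
      using br by blast+
  qed
  have square: "schouten_square_zero A C"
    if C: "\<And>c x. c \<in> A \<Longrightarrow> x \<in> coords c \<Longrightarrow> C c x = ?Re a c x" for C a
    unfolding schouten_square_zero_def
  proof (intro ballI allI)
    fix c x \<alpha> \<beta> \<gamma> assume c: "c \<in> A" and x: "x \<in> coords c"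
    show "schouten (C c) (C c) x \<alpha> \<beta> \<gamma> = 0"
    proof (rule schouten_square_Re_multiple[where B = "\<pi> c", OF open_coords[OF c] x T10[OF c] C[OF c]])
      show "dbar (\<lambda>y. \<pi> c y (dz j) (dz k)) x = (\<lambda>v. 0)" for j k
        using hol c x unfolding dbar_closed_def by blast
      show "schouten (\<pi> c) (\<pi> c) x \<alpha> \<beta> \<gamma> = 0" for \<alpha> \<beta> \<gamma>
        using poisson c x unfolding schouten_square_zero_def by blast
    qed (use diff c x in auto)
  qed
  show ?thesis
  proof (intro conjI allI impI ballI)
    show "\<exists>\<pi>R \<pi>I. real_imag_decomposition A \<pi> \<pi>R \<pi>I"
      using exist by blast
  next
    fix B :: "(complex ^ 'n) bivector" assume "B \<in> wedge_space UNIV UNIV"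
    then show "\<exists>!t. type_components B t"
      using type_components_exist type_components_unique by blast
  next
    fix \<pi>R \<pi>I assume dec: "real_imag_decomposition A \<pi> \<pi>R \<pi>I"
    note R = parts(1)[OF dec] and I = parts(2)[OF dec]
    show "poisson_tensor X A \<pi>R" "poisson_tensor X A \<pi>I"
      using dec mfd square[of \<pi>R, OF R] square[of \<pi>I, OF I]
      by (auto simp: poisson_tensor_def real_imag_decomposition_def)
    {
      fix c x assume c: "c \<in> A" "x \<in> coords c"
      show "type_components (\<pi>R c x)
          (\<lambda>\<alpha> \<beta>. \<pi> c x \<alpha> \<beta> / 2, \<lambda>\<alpha> \<beta>. 0, \<lambda>\<alpha> \<beta>. cnj_bivector (\<pi> c x) \<alpha> \<beta> / 2)"
        using components[OF c, of 1] by (simp add: R[OF c])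
      show "type_components (\<pi>I c x)
          (\<lambda>\<alpha> \<beta>. \<pi> c x \<alpha> \<beta> / (2 * \<i>), \<lambda>\<alpha> \<beta>. 0, \<lambda>\<alpha> \<beta>. - cnj_bivector (\<pi> c x) \<alpha> \<beta> / (2 * \<i>))"
      proof -
        have "- \<i> / 2 * z = z / (2 * \<i>)" "cnj (- \<i>) / 2 * z = - z / (2 * \<i>)" for z
          by (simp_all add: field_simps)
        then show ?thesis
          using components[OF c, of "- \<i>"] by (simp only: I[OF c])
      qed
    }
    fix U f g p
    assume "openin X U \<and> holomorphic_on_mfd A U f \<and> holomorphic_on_mfd A U g" and p: "p \<in> U"
    then have U: "openin X U" and fg: "holomorphic_on_mfd A U f" "holomorphic_on_mfd A U g"
      by auto
    note bR = brackets[of \<pi>R, OF R U p fg] and bI = brackets[of \<pi>I, OF I U p fg]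
    show "ext_bracket A \<pi>R f g p = 1 / 2 * bracket A \<pi> f g p"
      "ext_bracket A \<pi>R (cnj \<circ> f) (cnj \<circ> g) p = 1 / 2 * cnj (bracket A \<pi> f g p)"
      "ext_bracket A \<pi>R f (cnj \<circ> g) p = 0"
      "ext_bracket A \<pi>I f g p = - \<i> / 2 * bracket A \<pi> f g p"
      "ext_bracket A \<pi>I (cnj \<circ> f) (cnj \<circ> g) p = \<i> / 2 * cnj (bracket A \<pi> f g p)"
      "ext_bracket A \<pi>I f (cnj \<circ> g) p = 0"
      by (simp_all add: bR bI)
  qed
qed

end
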